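(* For real $\nu>-1$ let $\varphi_\nu(z)=2^{\nu}\Gamma(\nu+1)z^{1-\nu}J_\nu(z)$, where $J_\nu$ is the Bessel function of the first kind of order $\nu$, and let $r^\star(\varphi_\nu)$ be its radius of starlikeness. Then, as $\nu\to+\infty$ through real values, the square of $r^\star(\varphi_\nu)$ has the asymptotic expansion \[ (r^\star(\varphi_\nu))^2\sim 2\nu\left(1+\sum_{k=1}^\infty\frac{\rho_k}{\nu^k}\right)=2\nu\left(1+\frac{1}{2\nu}+\frac{1}{2\nu^2}-\frac{1}{2\nu^3}-\frac{1}{2\nu^4}+\cdots\right), \] where the coefficients $\rho_k$ ($k\ge1$) are determined recursively by \[ \rho_k=(-1)^{k+1}-\sum_{n=1}^{k-1}(-1)^{k-n}\rho_n-\sum_{n=2}^{k+1}2^{n+1}\sum_{m=0}^{k-n+1}\sigma^{(n)}_{k-n-m+1}\,\mathsf{A}_{n,m}(\rho_1,\rho_2,\ldots,\rho_m). \] (In particular $\rho_1=\tfrac12$, $\rho_2=\tfrac12$, $\rho_3=-\tfrac12$, $\rho_4=-\tfrac12$.)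
   Context: The function $\varphi_\nu$ is understood as the entire function $\varphi_\nu(z)=z\sum_{j\ge0}\frac{(-1)^j (z^2/4)^j}{j!\,(\nu+1)_j}$ with $(a)_j=a(a+1)\cdots(a+j-1)$; it satisfies $\varphi_\nu(0)=0$, $\varphi_\nu'(0)=1$. For a function $f$ with $f(0)=0$, $f'(0)=1$, the radius of starlikeness is \[ r^{\star}(f)=\sup\left\{r>0:\ \Re\left(\frac{zf'(z)}{f(z)}\right)>0\ \text{for all } z\in\mathbb{D}_r\right\},\qquad \mathbb{D}_r=\{z\in\mathbb{C}:|z|<r\}, \] where $zf'(z)/f(z)$ is given its limiting value $1$ at $z=0$ (and the condition requires the quotient to be finite on $\mathbb{D}_r$). The numbers $\sigma_m^{(k)}$ ($k\ge1$, $m\ge0$) are defined by \[ \sigma_m^{(1)}=\frac{(-1)^m}{4},\qquad \sigma_m^{(k)}=\sum_{i=0}^m\sum_{j=0}^i\sum_{n=1}^{k-1}(-k)^{m-i}\sigma_j^{(n)}\sigma_{i-j}^{(k-n)}\quad(k\ge2). \] The ordinary potential polynomials $\mathsf{A}_{\mu,n}$ ($\mu\in\mathbb{C}$, $n\ge0$) are defined by the generating function (formal power series in $z$) \[ \left(1+\sum_{n=1}^\infty x_nz^n\right)^\mu=\sum_{n=0}^\infty\mathsf{A}_{\mu,n}(x_1,x_2,\ldots,x_n)z^n , \] so $\mathsf{A}_{\mu,0}=1$, $\mathsf{A}_{\mu,1}=\mu x_1$, $\mathsf{A}_{\mu,2}=\mu x_2+\binom{\mu}{2}x_1^2$. Empty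 sums are zero. The asymptotic expansion is in the Poincaré sense: for every $N\ge1$, $\frac{(r^\star(\varphi_\nu))^2}{2\nu}=1+\sum_{k=1}^{N-1}\rho_k\nu^{-k}+\mathcal{O}_N(\nu^{-N})$ as $\nu\to+\infty$. *)

theory Defs
  imports
    "HOL-Analysis.Analysis"
    "HOL-Library.Landau_Symbols"
    "HOL-Computational_Algebra.Formal_Power_Series"
begin

text \<open>
  Bessel function of the first kind, with the principal branch of the power.
\<close>

definition bessel_J :: "real \<Rightarrow> complex \<Rightarrow> complex" where
  "bessel_J \<nu> z = (z / 2) powr of_real \<nu> *
     (\<Sum>j. (-1) ^ j / (fact j * Gamma (of_real \<nu> + of_nat j + 1)) * (z / 2) ^ (2 * j))"

text \<open>
  The entire function that extends \<open>2\<^sup>\<nu> \<Gamma>(\<nu>+1) z\<^sup>1\<^sup>-\<^sup>\<nu> J\<^sub>\<nu>(z)\<close>;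
  see \<open>phi_eq_bessel_J\<close> below.
\<close>

definition phi :: "real \<Rightarrow> complex \<Rightarrow> complex" where
  "phi \<nu> z = z * (\<Sum>j. (-1) ^ j * (z\<^sup>2 / 4) ^ j / (fact j * pochhammer (of_real \<nu> + 1) j))"

lemma phi_eq_bessel_J:
  assumes nu: "\<nu> > -1" and z: "z \<noteq> 0"
  shows "phi \<nu> z = of_real (2 powr \<nu> * Gamma (\<nu> + 1)) * z powr (1 - of_real \<nu>) * bessel_J \<nu> z"
proof -
  define a :: complex where "a = of_real \<nu> + 1"
  define F where "F = (\<lambda>j. (-1) ^ j * (z\<^sup>2 / 4) ^ j / (fact j * pochhammer a j))"
  define G where "G = (\<lambda>j. (-1) ^ j / (fact j * Gamma (of_real \<nu> + of_nat j + 1)) * (z / 2) ^ (2 * j))"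
  have a_real: "a = of_real (\<nu> + 1)" by (simp add: a_def)
  have a_notin: "a \<notin> \<int>\<^sub>\<le>\<^sub>0"
    unfolding a_real of_real_in_nonpos_Ints_iff using nu by (auto elim!: nonpos_Ints_cases)
  have Ga: "Gamma a \<noteq> 0" using a_notin by (simp add: Gamma_eq_zero_iff)
  have GF: "G j = F j / Gamma a" for j
  proof -
    have "Gamma (of_real \<nu> + of_nat j + 1) = pochhammer a j * Gamma a"
      using pochhammer_Gamma[OF a_notin, of j] Ga by (simp add: a_def add_ac)
    moreover have "(z / 2) ^ (2 * j) = (z\<^sup>2 / 4) ^ j"
      by (simp add: power_mult power_divide)
    ultimately show ?thesis by (simp add: F_def G_def)
  qed
  have F_sum: "summable F"
  proof (rule summable_comparison_test')
    let ?c = "min 1 (\<nu> + 1)"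
    have c: "?c > 0" using nu by simp
    show "summable (\<lambda>j. (norm (z\<^sup>2 / 4) / ?c) ^ j / fact j)"
      using summable_exp_generic[of "norm (z\<^sup>2 / 4) / ?c"] by (simp add: field_simps scaleR_conv_of_real)
    fix j :: nat assume "j \<ge> 0"
    have "?c ^ j \<le> pochhammer (\<nu> + 1) j"
    proof (induction j)
      case (Suc j)
      have "?c ^ j * ?c \<le> pochhammer (\<nu> + 1) j * (\<nu> + 1 + of_nat j)"
        using Suc c nu by (intro mult_mono) (auto intro: less_imp_le[OF pochhammer_pos])
      thus ?case by (simp add: pochhammer_Suc mult.commute)
    qed simp
    moreover have "norm (pochhammer a j) = pochhammer (\<nu> + 1) j"
    proof -
      have "pochhammer (\<nu> + 1) j > 0" using nu by (intro pochhammer_pos) simp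
      thus ?thesis unfolding a_real pochhammer_of_real norm_of_real by (rule abs_of_pos)
    qed
    ultimately have P: "?c ^ j \<le> norm (pochhammer a j)" by simp
    have "norm (F j) = norm (z\<^sup>2 / 4) ^ j / (fact j * norm (pochhammer a j))"
      by (simp add: F_def norm_mult norm_divide norm_power)
    also have "\<dots> \<le> norm (z\<^sup>2 / 4) ^ j / (fact j * ?c ^ j)"
    proof (intro divide_left_mono mult_left_mono mult_pos_pos P)
      show cj: "?c ^ j > 0" using c by (rule zero_less_power)
      show "norm (pochhammer a j) > 0" using cj P by (rule order.strict_trans2)
    qed auto
    also have "\<dots> = (norm (z\<^sup>2 / 4) / ?c) ^ j / fact j"
      by (simp add: power_divide mult.commute)
    finally show "norm (F j) \<le> (norm (z\<^sup>2 / 4) / ?c) ^ j / fact j" .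
  qed
  have S: "suminf G = suminf F / Gamma a"
    using suminf_divide[OF F_sum, of "Gamma a"] GF by (simp cong: suminf_cong)
  have Lnz: "Ln (z / 2) = Ln z - of_real (ln 2)"
    using Ln_divide_of_real[of 2 z] z by simp
  have two: "complex_of_real (2 powr \<nu>) = exp (of_real (\<nu> * ln 2))"
    by (simp add: powr_def exp_of_real del: of_real_mult)
  have "complex_of_real (2 powr \<nu>) * (z powr (1 - of_real \<nu>) * (z / 2) powr of_real \<nu>) = exp (Ln z)"
    using z unfolding two by (simp add: powr_def Lnz exp_add[symmetric] algebra_simps)
  hence P: "complex_of_real (2 powr \<nu>) * (z powr (1 - of_real \<nu>) * (z / 2) powr of_real \<nu>) = z"
    using z by simp
  have Gr: "complex_of_real (Gamma (\<nu> + 1)) = Gamma a"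
    unfolding a_real by (simp only: Gamma_complex_of_real)
  have "of_real (2 powr \<nu> * Gamma (\<nu> + 1)) * z powr (1 - of_real \<nu>) * bessel_J \<nu> z
      = (complex_of_real (2 powr \<nu>) * (z powr (1 - of_real \<nu>) * (z / 2) powr of_real \<nu>)) *
        (Gamma a * suminf G)"
    unfolding bessel_J_def G_def[symmetric] of_real_mult Gr by (simp only: mult_ac)
  also have "\<dots> = z * suminf F" unfolding P S using Ga by simp
  finally show ?thesis by (simp add: phi_def F_def a_def)
qed

text \<open>
  Radius of starlikeness of a normalised function (\<open>f 0 = 0\<close>, \<open>deriv f 0 = 1\<close>).
  It may be infinite, hence the extended reals.  At the origin the quotient
  \<open>z f'(z) / f(z)\<close> takes its limit \<open>1\<close>; elsewhere on the disc it has to be finite,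
  i.e. \<open>f\<close> must not vanish there.
\<close>

definition starlike_quotient :: "(complex \<Rightarrow> complex) \<Rightarrow> complex \<Rightarrow> complex" where
  "starlike_quotient f z = (if z = 0 then 1 else z * deriv f z / f z)"

definition starlikeness_radius :: "(complex \<Rightarrow> complex) \<Rightarrow> ereal" where
  "starlikeness_radius f = Sup {ereal r | r. r > 0 \<and>
     (\<forall>z\<in>ball 0 r. (z \<noteq> 0 \<longrightarrow> f z \<noteq> 0) \<and> Re (starlike_quotient f z) > 0)}"

text \<open>
  \<open>sigma k m\<close> stands for \<open>\<sigma>\<^sub>m\<^sup>(\<^sup>k\<^sup>)\<close>, with \<open>k \<ge> 1\<close>; the value at \<open>k = 0\<close> is a dummy.
\<close>

function sigma :: "nat \<Rightarrow> nat \<Rightarrow> real" where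
  "sigma k m =
     (if k = 0 then 0
      else if k = 1 then (-1) ^ m / 4
      else \<Sum>i=0..m. \<Sum>j=0..i. \<Sum>n=1..k-1.
             (- real k) ^ (m - i) * sigma n j * sigma (k - n) (i - j))"
  by auto
termination by (relation "Wellfounded.measure fst") auto

declare sigma.simps [simp del]

text \<open>
  \<open>potential_poly \<mu> n x\<close> is the coefficient of \<open>z\<^sup>n\<close> in
  \<open>(1 + x\<^sub>1 z + x\<^sub>2 z\<^sup>2 + \<dots>)\<^sup>\<mu>\<close>, i.e. in the composition of the binomial series
  \<open>(1 + z)\<^sup>\<mu>\<close> with \<open>x\<^sub>1 z + x\<^sub>2 z\<^sup>2 + \<dots>\<close>.  It depends only on \<open>x 1, \<dots>, x n\<close>.
\<close>

definition potential_poly :: "'a::field_char_0 \<Rightarrow> nat \<Rightarrow> (nat \<Rightarrow> 'a) \<Rightarrow> 'a" where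
  "potential_poly \<mu> n x =
     fps_nth (fps_compose (fps_binomial \<mu>) (Abs_fps (\<lambda>i. if i = 0 then 0 else x i))) n"

lemma potential_poly_0: "potential_poly \<mu> 0 x = 1"
  by (simp add: potential_poly_def fps_compose_nth)

lemma potential_poly_1: "potential_poly \<mu> 1 x = \<mu> * x 1"
  by (simp add: potential_poly_def fps_compose_nth)

lemma potential_poly_2: "potential_poly \<mu> 2 x = \<mu> * x 2 + (\<mu> gchoose 2) * (x 1)\<^sup>2"
  by (simp add: potential_poly_def fps_compose_nth numeral_2_eq_2 fps_mult_nth power2_eq_square)

lemma potential_poly_of_nat:
  "potential_poly (of_nat k) n x = fps_nth (Abs_fps (\<lambda>i. if i = 0 then 1 else x i) ^ k) n"
proof -
  let ?g = "Abs_fps (\<lambda>i. if i = 0 then 0 else x i)"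
  have g0: "fps_nth ?g 0 = 0" by simp
  have "fps_compose (fps_binomial (of_nat k)) ?g = (1 + ?g) ^ k"
    by (simp add: fps_binomial_of_nat fps_compose_power[OF g0, symmetric] fps_compose_add_distrib)
  also have "1 + ?g = Abs_fps (\<lambda>i. if i = 0 then 1 else x i)"
    by (rule fps_ext) auto
  finally show ?thesis by (simp add: potential_poly_def)
qed

lemma potential_poly_cong:
  assumes "\<And>i. i \<in> {1..n} \<Longrightarrow> x i = y i"
  shows "potential_poly \<mu> n x = potential_poly \<mu> n y"
proof -
  have "fps_nth (Abs_fps (\<lambda>i. if i = 0 then 0 else x i) ^ k) m =
        fps_nth (Abs_fps (\<lambda>i. if i = 0 then 0 else y i) ^ k) m" if "m \<le> n" for k m
    using that
  proof (induction k arbitrary: m)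
    case (Suc k)
    show ?case unfolding power_Suc fps_mult_nth
      using Suc assms by (intro sum.cong refl arg_cong2[of _ _ _ _ "(*)"]) auto
  qed simp
  thus ?thesis by (simp add: potential_poly_def fps_compose_nth)
qed

text \<open>
  The argument of \<open>potential_poly\<close> is cut off at \<open>m\<close> only to make termination evident;
  \<open>rho_rec\<close> states the recursion without the cut-off.  The value at \<open>k = 0\<close> is a dummy.
\<close>

function rho :: "nat \<Rightarrow> real" where
  "rho k =
     (if k = 0 then 0
      else (-1) ^ (k + 1) - (\<Sum>n=1..k-1. (-1) ^ (k - n) * rho n)
           - (\<Sum>n=2..k+1. 2 ^ (n + 1) * (\<Sum>m=0..k+1-n. sigma n (k + 1 - n - m) *
               potential_poly (of_nat n) m (\<lambda>i. if i \<in> {1..m} then rho i else 0))))"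
  by auto
termination by (relation "Wellfounded.measure id") auto

declare rho.simps [simp del]

lemma rho_rec:
  assumes "k \<ge> 1"
  shows "rho k = (-1) ^ (k + 1) - (\<Sum>n=1..k-1. (-1) ^ (k - n) * rho n)
           - (\<Sum>n=2..k+1. 2 ^ (n + 1) *
               (\<Sum>m=0..k+1-n. sigma n (k + 1 - n - m) * potential_poly (of_nat n) m rho))"
proof -
  have "potential_poly (of_nat n) m (\<lambda>i. if i \<in> {1..m} then rho i else 0)
      = potential_poly (of_nat n) m rho" for n m
    by (rule potential_poly_cong) simp
  thus ?thesis using assms by (subst rho.simps) simp
qed

end

theory Submission
  imports Defs
begin

text \<open>
  Put \<open>\<epsilon> = 1/\<nu>\<close>, \<open>x = z\<^sup>2/(2\<nu>)\<close> and \<open>\<Phi>(x) = \<phi>\<^sub>\<nu>(z)/z\<close>.  Then \<open>z \<phi>\<^sub>\<nu>'(z)/\<phi>\<^sub>\<nu>(z) = 1 - G(x)\<close> with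
  \<open>G = -2 x \<Phi>'/\<Phi>\<close>.  Bessel's equation for \<open>\<Phi>\<close> becomes the Riccati equation
  \<open>x G' + \<nu> G = \<nu> x + G\<^sup>2/2\<close>, so that the coefficients \<open>c\<^sub>n\<close> of \<open>G\<close> obey
  \<open>c\<^sub>1 = 1/(1+\<epsilon>)\<close> and \<open>c\<^sub>n = \<epsilon>/(2(1+n\<epsilon>)) (c\<^sub>1 c\<^sub>n\<^sub>-\<^sub>1 + c\<^sub>2 c\<^sub>n\<^sub>-\<^sub>2 + \<dots> + c\<^sub>n\<^sub>-\<^sub>1 c\<^sub>1)\<close>.
  They are positive, and comparison with a quadratic equation (which is solved by the generating
  function of the Catalan numbers) gives \<open>c\<^sub>n \<le> (2\<epsilon>)\<^sup>n/\<epsilon>\<close>; this is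
  \<open>scaled_rayleigh_le\<close>.

  Two conclusions follow.  First, \<open>G\<close> converges for \<open>\<bar>x\<bar> < \<nu>/2\<close>, \<open>\<Phi>\<close> has no zeros there, and since
  \<open>\<bar>G(x)\<bar> \<le> G(\<bar>x\<bar>)\<close>, the real part of \<open>1 - G\<close> is positive exactly up to the positive solution
  \<open>X\<close> of \<open>G(X) = 1\<close>.  So the square of the radius of starlikeness is \<open>2\<nu>X\<close>
  (\<open>starlikeness_radius_phi\<close>), without any information on the zeros of Bessel functions.

  Secondly, \<open>c\<^sub>n\<close> is a rational function of \<open>\<epsilon>\<close> whose expansion at \<open>0\<close> is
  \<open>2\<^sup>n\<^sup>+\<^sup>1 \<epsilon>\<^sup>n\<^sup>-\<^sup>1 \<Sum>\<^sub>m \<sigma>\<^sub>m\<^sup>(\<^sup>n\<^sup>) \<epsilon>\<^sup>m\<close> (\<open>scaled_rayleigh_fps_expansion\<close>).  The recursion for \<open>\<rho>\<^sub>k\<close> says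
  precisely that \<open>1 + \<rho>\<^sub>1 \<epsilon> + \<rho>\<^sub>2 \<epsilon>\<^sup>2 + \<dots>\<close> solves \<open>G(X) = 1\<close> as a formal power series in \<open>\<epsilon>\<close>
  (\<open>rho_convolution\<close>).  The truncation at order \<open>N\<close> therefore solves the equation up to
  \<open>O(\<epsilon>\<^sup>N)\<close>; the part of \<open>G\<close> beyond \<open>x\<^sup>N\<close> is \<open>O(\<epsilon>\<^sup>N)\<close> by the bound on \<open>c\<^sub>n\<close>.  As \<open>G\<close> grows at least
  as fast as its linear term \<open>x/(1+\<epsilon>)\<close>, an approximate solution is close to \<open>X\<close>
  (\<open>solution_distance_le\<close>), with the same order of error.
\<close>

section \<open>The scaled Rayleigh sums\<close>

text \<open>
  In terms of the zeros \<open>j\<^sub>1, j\<^sub>2, \<dots>\<close> of \<open>J\<^sub>\<nu>\<close> and \<open>\<epsilon> = 1/\<nu>\<close>, the \<open>n\<close>-th number is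
  \<open>2 (2\<nu>)\<^sup>n (j\<^sub>1\<^sup>-\<^sup>2\<^sup>n + j\<^sub>2\<^sup>-\<^sup>2\<^sup>n + \<dots>)\<close>.  The recursion is the convolution formula for the Rayleigh
  sums; taking it as the definition gives positivity at once and avoids any reference to zeros.
  The scaling makes the \<open>n\<close>-th number of order \<open>\<epsilon>\<^sup>n\<^sup>-\<^sup>1\<close>.
\<close>

function scaled_rayleigh :: "real \<Rightarrow> nat \<Rightarrow> real" where
  "scaled_rayleigh \<epsilon> n =
     (if n = 0 then 0
      else if n = 1 then 1 / (1 + \<epsilon>)
      else \<epsilon> / (2 * (1 + real n * \<epsilon>)) *
             (\<Sum>i=1..n-1. scaled_rayleigh \<epsilon> i * scaled_rayleigh \<epsilon> (n - i)))"
  by auto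
termination by (relation "Wellfounded.measure snd") auto

declare scaled_rayleigh.simps [simp del]

lemma scaled_rayleigh_0 [simp]: "scaled_rayleigh \<epsilon> 0 = 0"
  by (simp add: scaled_rayleigh.simps)

lemma scaled_rayleigh_1: "scaled_rayleigh \<epsilon> (Suc 0) = 1 / (1 + \<epsilon>)"
  by (simp add: scaled_rayleigh.simps)

lemma scaled_rayleigh_rec:
  assumes "n \<ge> 2"
  shows "scaled_rayleigh \<epsilon> n = \<epsilon> / (2 * (1 + real n * \<epsilon>)) *
           (\<Sum>i=1..n-1. scaled_rayleigh \<epsilon> i * scaled_rayleigh \<epsilon> (n - i))"
  using assms by (subst scaled_rayleigh.simps) simp

lemma scaled_rayleigh_nonneg:
  assumes "\<epsilon> \<ge> 0"
  shows "scaled_rayleigh \<epsilon> n \<ge> 0"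
proof (induction n rule: less_induct)
  case (less n)
  show ?case
    using assms less
    by (subst scaled_rayleigh.simps) (auto intro!: sum_nonneg mult_nonneg_nonneg divide_nonneg_nonneg)
qed

text \<open>
  Summing the recursion bounds the partial sums at a point \<open>x\<close> by
  \<open>s\<^sub>N\<^sub>+\<^sub>1 \<le> x + \<epsilon>/2 s\<^sub>N\<^sup>2\<close>.  The largest \<open>x\<close> for which \<open>s = x + \<epsilon>/2 s\<^sup>2\<close> has a real solution is
  \<open>1/(2\<epsilon>)\<close>, with the double root \<open>s = 1/\<epsilon>\<close>; at this \<open>x\<close> the bound \<open>s\<^sub>N \<le> 1/\<epsilon>\<close> is inductive.
\<close>

lemma scaled_rayleigh_partial_sum_le:
  assumes e: "\<epsilon> > 0"
  shows "(\<Sum>n\<le>N. scaled_rayleigh \<epsilon> n * (1 / (2 * \<epsilon>)) ^ n) \<le> 1 / \<epsilon>"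
proof (induction N)
  case 0
  show ?case using e by simp
next
  case (Suc N)
  define a where "a = (\<lambda>n. scaled_rayleigh \<epsilon> n * (1 / (2 * \<epsilon>)) ^ n)"
  have a_nonneg: "a n \<ge> 0" for n
    using e by (simp add: a_def scaled_rayleigh_nonneg)
  have a1: "a 1 \<le> 1 / (2 * \<epsilon>)"
  proof -
    have "1 / (1 + \<epsilon>) \<le> 1" using e by simp
    hence "1 / (1 + \<epsilon>) * (1 / (2 * \<epsilon>)) \<le> 1 * (1 / (2 * \<epsilon>))"
      using e by (intro mult_right_mono) auto
    thus ?thesis by (simp add: a_def scaled_rayleigh_1)
  qed
  have a_rec: "a n \<le> \<epsilon> / 2 * (\<Sum>i=1..n-1. a i * a (n - i))" if n: "n \<ge> 2" for n
  proof -
    have "(\<Sum>i=1..n-1. a i * a (n - i)) =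
          (\<Sum>i=1..n-1. scaled_rayleigh \<epsilon> i * scaled_rayleigh \<epsilon> (n - i)) * (1 / (2 * \<epsilon>)) ^ n"
      unfolding sum_distrib_right
    proof (intro sum.cong refl)
      fix i assume "i \<in> {1..n-1}"
      hence "(1 / (2 * \<epsilon>)) ^ n = (1 / (2 * \<epsilon>)) ^ i * (1 / (2 * \<epsilon>)) ^ (n - i)"
        by (subst power_add[symmetric]) auto
      thus "a i * a (n - i) =
            scaled_rayleigh \<epsilon> i * scaled_rayleigh \<epsilon> (n - i) * (1 / (2 * \<epsilon>)) ^ n"
        by (simp add: a_def)
    qed
    hence "a n = \<epsilon> / (2 * (1 + real n * \<epsilon>)) * (\<Sum>i=1..n-1. a i * a (n - i))"
      using n by (simp add: a_def scaled_rayleigh_rec)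
    also have "\<dots> \<le> \<epsilon> / 2 * (\<Sum>i=1..n-1. a i * a (n - i))"
      using e by (intro mult_right_mono divide_left_mono sum_nonneg mult_nonneg_nonneg a_nonneg)
        (auto intro: add_pos_nonneg)
    finally show ?thesis .
  qed
  \<comment> \<open>Pairs \<open>(i, n - i)\<close> that occur for \<open>n \<le> N + 1\<close> all lie in the square \<open>{..N} \<times> {..N}\<close>.\<close>
  have sub: "(\<Sum>n\<in>{2..Suc N}. \<Sum>i=1..n-1. a i * a (n - i)) \<le> (\<Sum>n\<le>N. a n) * (\<Sum>n\<le>N. a n)"
  proof -
    have "(\<Sum>n\<in>{2..Suc N}. \<Sum>i=1..n-1. a i * a (n - i)) =
          (\<Sum>p\<in>Sigma {2..Suc N} (\<lambda>n. {1..n-1}). a (snd p) * a (fst p - snd p))"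
      by (subst sum.Sigma) (auto simp: case_prod_unfold)
    also have "\<dots> = (\<Sum>q\<in>(\<lambda>p. (snd p, fst p - snd p)) ` Sigma {2..Suc N} (\<lambda>n. {1..n-1}). a (fst q) * a (snd q))"
      by (subst sum.reindex) (auto simp: inj_on_def)
    also have "\<dots> \<le> (\<Sum>q\<in>{..N} \<times> {..N}. a (fst q) * a (snd q))"
      by (intro sum_mono2) (auto intro!: mult_nonneg_nonneg a_nonneg)
    also have "\<dots> = (\<Sum>n\<le>N. a n) * (\<Sum>n\<le>N. a n)"
      by (simp add: sum_product sum.cartesian_product case_prod_unfold)
    finally show ?thesis .
  qed
  have "{..Suc N} = {0} \<union> {1} \<union> {2..Suc N}" by auto
  hence "(\<Sum>n\<le>Suc N. a n) = a 1 + (\<Sum>n\<in>{2..Suc N}. a n)"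
    by (simp add: sum.union_disjoint a_def)
  also have "\<dots> \<le> 1 / (2 * \<epsilon>) + (\<Sum>n\<in>{2..Suc N}. \<epsilon> / 2 * (\<Sum>i=1..n-1. a i * a (n - i)))"
    using a1 by (intro add_mono sum_mono a_rec) auto
  also have "\<dots> \<le> 1 / (2 * \<epsilon>) + \<epsilon> / 2 * ((\<Sum>n\<le>N. a n) * (\<Sum>n\<le>N. a n))"
    using sub e unfolding sum_distrib_left[symmetric] by simp
  also have "\<dots> \<le> 1 / (2 * \<epsilon>) + \<epsilon> / 2 * (1 / \<epsilon> * (1 / \<epsilon>))"
    using Suc.IH e
    by (intro add_left_mono mult_left_mono mult_mono sum_nonneg a_nonneg)
      (auto simp: a_def)
  also have "\<dots> = 1 / \<epsilon>" using e by (simp add: field_simps)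
  finally show ?case by (simp add: a_def)
qed

lemma scaled_rayleigh_le:
  assumes e: "\<epsilon> > 0"
  shows "scaled_rayleigh \<epsilon> n \<le> (2 * \<epsilon>) ^ n / \<epsilon>"
proof -
  have "scaled_rayleigh \<epsilon> n * (1 / (2 * \<epsilon>)) ^ n \<le> (\<Sum>n\<le>n. scaled_rayleigh \<epsilon> n * (1 / (2 * \<epsilon>)) ^ n)"
    using e by (intro member_le_sum) (auto intro!: mult_nonneg_nonneg scaled_rayleigh_nonneg)
  also have "\<dots> \<le> 1 / \<epsilon>" by (rule scaled_rayleigh_partial_sum_le[OF e])
  finally show ?thesis using e by (simp add: field_simps power_divide)
qed

text \<open>
  The field is left open because the series is needed twice: over the complex numbers it is
  \<open>-2x\<close> times the logarithmic derivative of the Bessel series, over the reals it is the increasing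
  function whose level set at height \<open>1\<close> determines the radius.
\<close>

definition rayleigh_fps :: "real \<Rightarrow> 'a :: real_normed_field fps" where
  "rayleigh_fps \<epsilon> = Abs_fps (\<lambda>n. of_real (scaled_rayleigh \<epsilon> n))"

lemma rayleigh_fps_nth [simp]: "fps_nth (rayleigh_fps \<epsilon>) n = of_real (scaled_rayleigh \<epsilon> n)"
  by (simp add: rayleigh_fps_def)

lemma fps_conv_radius_rayleigh_ge:
  assumes e: "\<epsilon> > 0"
  shows "fps_conv_radius (rayleigh_fps \<epsilon> :: 'a :: {banach, real_normed_field} fps) \<ge> ereal (1 / (2 * \<epsilon>))"
  unfolding fps_conv_radius_def
proof (rule conv_radius_geI_ex)
  fix r assume r: "0 < r" "ereal r < ereal (1 / (2 * \<epsilon>))"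
  have q: "2 * \<epsilon> * r < 1" using r e by (simp add: field_simps)
  have "summable (\<lambda>n. fps_nth (rayleigh_fps \<epsilon>) n * (of_real r :: 'a) ^ n)"
  proof (rule summable_comparison_test')
    show "summable (\<lambda>n. 1 / \<epsilon> * (2 * \<epsilon> * r) ^ n)"
      using q r e by (intro summable_mult summable_geometric) auto
  next
    fix n :: nat
    have "norm (fps_nth (rayleigh_fps \<epsilon>) n * (of_real r :: 'a) ^ n) = scaled_rayleigh \<epsilon> n * r ^ n"
      using r e scaled_rayleigh_nonneg[of \<epsilon> n] by (simp add: norm_mult norm_power)
    also have "\<dots> \<le> (2 * \<epsilon>) ^ n / \<epsilon> * r ^ n"
      using r by (intro mult_right_mono scaled_rayleigh_le[OF e]) auto
    finally show "norm (fps_nth (rayleigh_fps \<epsilon>) n * (of_real r :: 'a) ^ n) \<le> 1 / \<epsilon> * (2 * \<epsilon> * r) ^ n"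
      by (simp add: power_mult_distrib)
  qed
  thus "\<exists>z :: 'a. norm z = r \<and> summable (\<lambda>n. fps_nth (rayleigh_fps \<epsilon>) n * z ^ n)"
    using r by (intro exI[of _ "of_real r"]) auto
qed

lemma less_fps_conv_radius_rayleigh:
  assumes "\<epsilon> > 0" "norm x < 1 / (2 * \<epsilon>)"
  shows "ereal (norm x) < fps_conv_radius (rayleigh_fps \<epsilon> :: 'a :: {banach, real_normed_field} fps)"
proof -
  have "ereal (norm x) < ereal (1 / (2 * \<epsilon>))" using assms(2) by (simp only: ereal_less_eq less_ereal.simps)
  also have "\<dots> \<le> fps_conv_radius (rayleigh_fps \<epsilon> :: 'a fps)"
    by (rule fps_conv_radius_rayleigh_ge[OF assms(1)])
  finally show ?thesis .
qed

section \<open>The logarithmic derivative of the Bessel series\<close>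

text \<open>
  This is \<open>\<phi>\<^sub>\<nu>(z)/z\<close> as a power series in \<open>x = z\<^sup>2/(2\<nu>)\<close>.  In this variable the radius of
  starlikeness corresponds to a point that stays bounded as \<open>\<nu> \<rightarrow> \<infinity>\<close>.
\<close>

definition bessel_fps :: "real \<Rightarrow> complex fps" where
  "bessel_fps \<nu> =
     Abs_fps (\<lambda>j. (-1) ^ j * of_real (\<nu> / 2) ^ j / (fact j * pochhammer (of_real \<nu> + 1) j))"

lemma bessel_fps_nth_Suc:
  assumes "\<nu> > 0"
  shows "of_nat (Suc j) * (of_real \<nu> + 1 + of_nat j) * fps_nth (bessel_fps \<nu>) (Suc j)
           = - of_real (\<nu> / 2) * fps_nth (bessel_fps \<nu>) j"
proof -
  have "Re (of_real \<nu> + 1 + of_nat j :: complex) > 0" using assms by simp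
  hence nz: "(of_real \<nu> + 1 + of_nat j :: complex) \<noteq> 0" by force
  have nz': "pochhammer (of_real \<nu> + 1 :: complex) j \<noteq> 0"
  proof
    assume "pochhammer (of_real \<nu> + 1 :: complex) j = 0"
    then obtain k where "of_real \<nu> + 1 = - (of_nat k :: complex)"
      by (auto simp: pochhammer_eq_0_iff)
    hence "Re (of_real \<nu> + 1) = Re (- (of_nat k :: complex))" by (rule arg_cong)
    thus False using assms by simp
  qed
  show ?thesis using nz nz'
    by (simp add: bessel_fps_def pochhammer_Suc divide_simps del: of_nat_Suc)
qed

lemma bessel_fps_ode:
  assumes "\<nu> > 0"
  defines "\<Phi> \<equiv> bessel_fps \<nu>"
  shows "fps_X * fps_deriv (fps_deriv \<Phi>) + fps_const (of_real \<nu> + 1) * fps_deriv \<Phi>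
           + fps_const (of_real (\<nu> / 2)) * \<Phi> = 0"
proof (rule fps_ext)
  fix n
  have "fps_nth (fps_X * fps_deriv (fps_deriv \<Phi>) + fps_const (of_real \<nu> + 1) * fps_deriv \<Phi>
           + fps_const (of_real (\<nu> / 2)) * \<Phi>) n
      = of_nat (Suc n) * (of_real \<nu> + 1 + of_nat n) * fps_nth \<Phi> (Suc n) + of_real (\<nu> / 2) * fps_nth \<Phi> n"
    by (cases n) (simp_all add: algebra_simps)
  thus "fps_nth (fps_X * fps_deriv (fps_deriv \<Phi>) + fps_const (of_real \<nu> + 1) * fps_deriv \<Phi>
           + fps_const (of_real (\<nu> / 2)) * \<Phi>) n = fps_nth 0 n"
    using bessel_fps_nth_Suc[OF assms(1), of n] by (simp add: \<Phi>_def)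
qed

lemma bessel_fps_nth_0 [simp]: "fps_nth (bessel_fps \<nu>) 0 = 1"
  by (simp add: bessel_fps_def)

text \<open>
  A logarithmic derivative turns a linear second-order equation into a Riccati equation:
  differentiate \<open>G \<Phi> = -2 X \<Phi>'\<close>, eliminate \<open>\<Phi>''\<close> by the Bessel equation and \<open>X \<Phi>'\<close> by \<open>G\<close>, and
  cancel \<open>\<Phi>\<close>.  Working with formal series keeps the cancellation free of any knowledge
  about zeros.
\<close>

lemma riccati_of_bessel_fps:
  assumes nu: "\<nu> > 0"
    and G: "G * bessel_fps \<nu> = - (fps_const 2 * fps_X * fps_deriv (bessel_fps \<nu>))"
  shows "fps_X * fps_deriv G + fps_const (of_real \<nu>) * G
           = fps_const (of_real \<nu>) * fps_X + fps_const (1 / 2) * G ^ 2"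
proof -
  define P where "P = bessel_fps \<nu>"
  define c where "c = fps_const (of_real \<nu> :: complex)"
  have ode: "fps_X * fps_deriv (fps_deriv P) + (c + 1) * fps_deriv P + fps_const (1/2) * c * P = 0"
    using bessel_fps_ode[OF nu] by (simp add: P_def c_def flip: fps_const_add)
  have half: "fps_const 2 * fps_const (1 / 2 :: complex) = 1" by simp
  have G': "G * P = - (fps_const 2 * fps_X * fps_deriv P)" using G by (simp add: P_def)
  have "fps_deriv (G * P) = fps_deriv (- (fps_const 2 * fps_X * fps_deriv P))"
    by (simp only: G')
  hence dG: "fps_deriv G * P + G * fps_deriv P =
      - (fps_const 2 * (fps_deriv P + fps_X * fps_deriv (fps_deriv P)))"
    by (simp add: algebra_simps)
  have "(fps_X * fps_deriv G + c * G - c * fps_X - fps_const (1 / 2) * G ^ 2) * P = 0"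
    using ode G' dG half by algebra
  moreover have "P \<noteq> 0" by (metis P_def bessel_fps_nth_0 fps_zero_nth zero_neq_one)
  ultimately have "fps_X * fps_deriv G + c * G - c * fps_X - fps_const (1 / 2) * G ^ 2 = 0"
    by (metis mult_eq_0_iff)
  thus ?thesis unfolding c_def by algebra
qed

text \<open>
  Comparing coefficients in the Riccati equation gives exactly the recursion of the scaled
  Rayleigh sums, so these are the coefficients of \<open>-2 X \<Phi>'/\<Phi>\<close>.
\<close>

lemma bessel_fps_log_deriv:
  assumes nu: "\<nu> > 0"
  shows "rayleigh_fps (1 / \<nu>) * bessel_fps \<nu> = - (fps_const 2 * fps_X * fps_deriv (bessel_fps \<nu>))"
proof -
  define G where "G = - (fps_const 2 * fps_X * fps_deriv (bessel_fps \<nu>)) * inverse (bessel_fps \<nu>)"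
  have inv: "inverse (bessel_fps \<nu>) * bessel_fps \<nu> = 1"
    by (rule inverse_mult_eq_1) simp
  have G: "G * bessel_fps \<nu> = - (fps_const 2 * fps_X * fps_deriv (bessel_fps \<nu>))"
    by (simp add: G_def mult.assoc inv del: fps_const_mult)
  have G0: "fps_nth G 0 = 0" by (simp add: G_def)
  \<comment> \<open>The coefficient of \<open>X\<^sup>n\<close> in the Riccati equation.\<close>
  have rec: "(of_nat n + of_real \<nu>) * fps_nth G n =
      (if n = 1 then of_real \<nu> else 0) + (\<Sum>i=0..n. fps_nth G i * fps_nth G (n - i)) / 2" for n
  proof -
    have "fps_nth (fps_X * fps_deriv G + fps_const (of_real \<nu>) * G) n =
      fps_nth (fps_const (of_real \<nu>) * fps_X + fps_const (1 / 2) * G ^ 2) n"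
      by (simp only: riccati_of_bessel_fps[OF nu G])
    thus ?thesis
      by (cases n) (auto simp: power2_eq_square fps_mult_nth[of G G] ring_distribs)
  qed
  have "fps_nth G n = of_real (scaled_rayleigh (1 / \<nu>) n)" for n
  proof (induction n rule: less_induct)
    case (less n)
    have "Re (of_nat n + of_real \<nu> :: complex) > 0" using nu by simp
    hence nz: "(of_nat n + of_real \<nu> :: complex) \<noteq> 0" by force
    show ?case
    proof (cases "n \<ge> 2")
      case True
      have "{0..n} = insert 0 (insert n {1..n-1})" using True by auto
      hence "(\<Sum>i=0..n. fps_nth G i * fps_nth G (n - i)) = (\<Sum>i=1..n-1. fps_nth G i * fps_nth G (n - i))"
        using True G0 by simp
      also have "\<dots> = of_real (\<Sum>i=1..n-1. scaled_rayleigh (1 / \<nu>) i * scaled_rayleigh (1 / \<nu>) (n - i))"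
        (is "_ = of_real ?S")
        unfolding of_real_sum of_real_mult using True by (intro sum.cong refl arg_cong2[of _ _ _ _ "(*)"] less) auto
      finally have "(of_nat n + of_real \<nu>) * fps_nth G n = of_real (?S / 2)"
        using rec[of n] True by simp
      also have "?S / 2 = (real n + \<nu>) * scaled_rayleigh (1 / \<nu>) n"
        using nu True by (simp add: scaled_rayleigh_rec divide_simps add_pos_pos)
      finally have "(of_nat n + of_real \<nu>) * fps_nth G n =
        (of_nat n + of_real \<nu>) * of_real (scaled_rayleigh (1 / \<nu>) n)" by simp
      thus ?thesis using nz by simp
    next
      case False
      hence "n = 0 \<or> n = 1" by auto
      thus ?thesis
      proof
        assume n: "n = 1"
        have "(1 + of_real \<nu>) * fps_nth G 1 = of_real \<nu>"
          using rec[of 1] G0 by simp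
        moreover have "of_real \<nu> = (1 + of_real \<nu>) * complex_of_real (\<nu> / (1 + \<nu>))"
          using nz n by simp
        ultimately have "fps_nth G 1 = of_real (\<nu> / (1 + \<nu>))"
          using nz n by (metis mult_left_cancel of_nat_1)
        moreover have "\<nu> / (1 + \<nu>) = 1 / (1 + 1 / \<nu>)" using nu by (simp add: field_simps)
        ultimately show ?thesis using n by (simp add: scaled_rayleigh_1)
      qed (simp add: G0)
    qed
  qed
  hence "G = rayleigh_fps (1 / \<nu>)" by (intro fps_ext) simp
  thus ?thesis using G by simp
qed

text \<open>
  Since \<open>(\<nu>+1)\<^sub>j \<ge> (\<nu>/2)\<^sup>j\<close>, the series is dominated by the exponential series.
\<close>

lemma fps_conv_radius_bessel:
  assumes nu: "\<nu> > 0"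
  shows "fps_conv_radius (bessel_fps \<nu>) = \<infinity>"
  unfolding fps_conv_radius_def
proof (rule conv_radius_inftyI'')
  fix z :: complex
  show "summable (\<lambda>n. fps_nth (bessel_fps \<nu>) n * z ^ n)"
  proof (rule summable_comparison_test')
    show "summable (\<lambda>n. norm z ^ n / fact n)"
      using summable_exp_generic[of "norm z"] by (simp add: divide_inverse mult.commute)
  next
    fix j :: nat
    have "(\<nu> / 2) ^ j \<le> pochhammer (\<nu> + 1) j"
    proof (induction j)
      case (Suc j)
      have "(\<nu> / 2) ^ j * (\<nu> / 2) \<le> pochhammer (\<nu> + 1) j * (\<nu> + 1 + of_nat j)"
        using Suc nu by (intro mult_mono) (auto intro: less_imp_le[OF pochhammer_pos])
      thus ?case by (simp add: pochhammer_Suc mult.commute)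
    qed simp
    moreover have pos: "pochhammer (\<nu> + 1) j > 0" using nu by (intro pochhammer_pos) simp
    moreover have "norm (pochhammer (of_real \<nu> + 1 :: complex) j) = pochhammer (\<nu> + 1) j"
    proof -
      have "pochhammer (of_real \<nu> + 1 :: complex) j = of_real (pochhammer (\<nu> + 1) j)"
        by (simp flip: pochhammer_of_real)
      thus ?thesis using pos by simp
    qed
    ultimately show "norm (fps_nth (bessel_fps \<nu>) j * z ^ j) \<le> norm z ^ j / fact j"
      using nu by (simp add: bessel_fps_def norm_mult norm_divide norm_power divide_simps power_divide)
        (simp add: mult.commute[of "norm z ^ j"] mult.commute[of "2 ^ j"] mult_right_mono)
  qed
qed

text \<open>
  On the disc \<open>\<bar>x\<bar> < \<nu>/2\<close>, where \<open>G = X l\<close> converges, the relation \<open>2 \<Phi>' = - l \<Phi>\<close> integrates to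
  \<open>\<Phi> exp L = 1\<close> with \<open>2 L' = l\<close>, and an exponential has no zeros.
\<close>

lemma eval_bessel_fps_nonzero:
  assumes nu: "\<nu> > 0" and x: "norm x < \<nu> / 2"
  shows "eval_fps (bessel_fps \<nu>) x \<noteq> 0"
proof -
  define \<Phi> where "\<Phi> = bessel_fps \<nu>"
  define G :: "complex fps" where "G = rayleigh_fps (1 / \<nu>)"
  define l where "l = fps_shift 1 G"
  define L where "L = fps_const (1 / 2) * fps_integral l 0"
  have G_eq: "G = fps_X * l"
    by (intro fps_ext) (auto simp: G_def l_def)
  have radG: "fps_conv_radius G \<ge> ereal (\<nu> / 2)"
    using fps_conv_radius_rayleigh_ge[of "1 / \<nu>", where 'a = complex] nu by (simp add: G_def)
  have dL: "fps_deriv L = fps_const (1 / 2) * l"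
    by (simp add: L_def fps_deriv_fps_integral)
  have radL: "fps_conv_radius L \<ge> ereal (\<nu> / 2)"
    unfolding fps_conv_radius_def
  proof (rule conv_radius_geI_ex)
    fix r assume r: "0 < r" "ereal r < ereal (\<nu> / 2)"
    have "summable (\<lambda>n. norm (fps_nth G n * of_real r ^ n))"
    proof (rule norm_summable_fps)
      show "ereal (norm (of_real r :: complex)) < fps_conv_radius G"
        using r less_le_trans[OF r(2) radG] by simp
    qed
    moreover have "norm (fps_nth L n * of_real r ^ n) \<le> norm (fps_nth G n * of_real r ^ n)" for n
    proof (cases n)
      case (Suc m)
      have "norm (fps_nth L n) = norm (fps_nth G n) / (2 * real n)"
        using Suc by (simp add: L_def l_def fps_integral_def norm_mult norm_divide norm_inverse field_simps
                           del: of_nat_Suc)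
      also have "\<dots> \<le> norm (fps_nth G n) / 1"
        using Suc by (intro divide_left_mono) auto
      finally show ?thesis by (simp add: norm_mult mult_right_mono)
    qed (simp add: L_def fps_integral_def)
    ultimately have "summable (\<lambda>n. fps_nth L n * of_real r ^ n)"
      by (rule summable_comparison_test'[where N = 0])
    thus "\<exists>z. norm z = r \<and> summable (\<lambda>n. fps_nth L n * z ^ n)"
      using r by (intro exI[of _ "of_real r"]) auto
  qed
  have "fps_X * (l * \<Phi>) = fps_X * (- (fps_const 2 * fps_deriv \<Phi>))"
    using bessel_fps_log_deriv[OF nu] unfolding G_def[symmetric] \<Phi>_def[symmetric] G_eq
    by (simp add: mult_ac)
  hence l\<Phi>: "l * \<Phi> = - (fps_const 2 * fps_deriv \<Phi>)"
    by (metis fps_X_neq_zero mult_left_cancel)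
  have d\<Phi>: "fps_deriv \<Phi> = - (fps_deriv L * \<Phi>)"
  proof -
    have "fps_deriv L * \<Phi> = fps_const (1 / 2) * (l * \<Phi>)" by (simp add: dL mult_ac)
    also have "\<dots> = - ((fps_const (1 / 2) * fps_const 2) * fps_deriv \<Phi>)"
      unfolding l\<Phi> by (simp only: mult_minus_right mult_ac)
    finally show ?thesis by simp
  qed
  have rad\<Phi>: "fps_conv_radius \<Phi> = \<infinity>" using fps_conv_radius_bessel[OF nu] by (simp add: \<Phi>_def)
  define g where "g = (\<lambda>x. eval_fps \<Phi> x * exp (eval_fps L x))"
  have "\<exists>c. \<forall>x\<in>ball 0 (\<nu> / 2). g x = c"
  proof (rule has_field_derivative_zero_constant)
    fix y :: complex assume "y \<in> ball 0 (\<nu> / 2)"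
    hence "ereal (norm y) < ereal (\<nu> / 2)" by simp
    hence y: "ereal (norm y) < fps_conv_radius L" using radL by (rule less_le_trans)
    have "eval_fps (fps_deriv \<Phi>) y = - (eval_fps (fps_deriv L) y * eval_fps \<Phi> y)"
    proof -
      have y': "ereal (norm y) < fps_conv_radius (fps_deriv L)"
        using y fps_conv_radius_deriv[of L] by (rule less_le_trans)
      have "ereal (norm y) < min (fps_conv_radius (fps_deriv L)) (fps_conv_radius \<Phi>)"
        using y' rad\<Phi> by simp
      hence "ereal (norm y) < fps_conv_radius (fps_deriv L * \<Phi>)"
        by (rule less_le_trans) (rule fps_conv_radius_mult)
      thus ?thesis
        using y' rad\<Phi> by (simp add: d\<Phi> eval_fps_minus eval_fps_mult)
    qed
    hence "eval_fps (fps_deriv \<Phi>) y * exp (eval_fps L y) +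
           exp (eval_fps L y) * eval_fps (fps_deriv L) y * eval_fps \<Phi> y = 0"
      by simp
    moreover have "(g has_field_derivative (eval_fps (fps_deriv \<Phi>) y * exp (eval_fps L y) +
           exp (eval_fps L y) * eval_fps (fps_deriv L) y * eval_fps \<Phi> y)) (at y within ball 0 (\<nu> / 2))"
      unfolding g_def using y rad\<Phi>
      by (auto intro!: derivative_eq_intros has_field_derivative_eval_fps)
    ultimately show "(g has_field_derivative 0) (at y within ball 0 (\<nu> / 2))" by simp
  qed simp
  then obtain c where c: "\<And>x. x \<in> ball 0 (\<nu> / 2) \<Longrightarrow> g x = c" by blast
  have "g 0 = 1" by (simp add: g_def eval_fps_at_0 \<Phi>_def L_def fps_integral_def)
  hence "g x = 1" using c[of 0] c[of x] x nu by simp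
  thus ?thesis by (auto simp: g_def \<Phi>_def)
qed

lemma phi_eq_eval_bessel_fps:
  assumes nu: "\<nu> > 0"
  shows "phi \<nu> z = z * eval_fps (bessel_fps \<nu>) (z\<^sup>2 / of_real (2 * \<nu>))"
proof -
  have "(z\<^sup>2 / 4) ^ j = of_real (\<nu> / 2) ^ j * (z\<^sup>2 / of_real (2 * \<nu>)) ^ j" for j
    using nu by (simp add: power_divide power_mult_distrib flip: of_real_power power_mult_distrib)
  thus ?thesis by (simp add: phi_def eval_fps_def bessel_fps_def mult_ac)
qed

section \<open>The radius as the solution of an equation\<close>

lemma starlike_quotient_phi:
  assumes nu: "\<nu> > 0" and z: "norm z < \<nu>"
  defines "x \<equiv> z\<^sup>2 / of_real (2 * \<nu>)"
  shows "z \<noteq> 0 \<Longrightarrow> phi \<nu> z \<noteq> 0"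
    and "starlike_quotient (phi \<nu>) z = 1 - eval_fps (rayleigh_fps (1 / \<nu>)) x"
proof -
  have x: "norm x < \<nu> / 2"
  proof -
    have "norm z ^ 2 < \<nu> ^ 2" using z by (intro power_strict_mono) auto
    thus ?thesis using nu by (simp add: x_def norm_divide norm_mult field_simps power2_eq_square)
  qed
  have nz: "eval_fps (bessel_fps \<nu>) x \<noteq> 0"
    by (rule eval_bessel_fps_nonzero[OF nu x])
  show "phi \<nu> z \<noteq> 0" if "z \<noteq> 0"
    using that nz by (simp add: phi_eq_eval_bessel_fps[OF nu] x_def)
  show "starlike_quotient (phi \<nu>) z = 1 - eval_fps (rayleigh_fps (1 / \<nu>)) x"
  proof (cases "z = 0")
    case True
    thus ?thesis by (simp add: starlike_quotient_def x_def eval_fps_at_0)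
  next
    case False
    let ?B = "bessel_fps \<nu>" and ?G = "rayleigh_fps (1 / \<nu>) :: complex fps"
    note rad = fps_conv_radius_bessel[OF nu]
    have radG: "ereal (norm x) < fps_conv_radius ?G"
      using nu x by (intro less_fps_conv_radius_rayleigh) auto
    have rad': "fps_conv_radius (fps_deriv ?B) = \<infinity>"
      using fps_conv_radius_deriv[of ?B] rad by simp
    have rad'': "fps_conv_radius (fps_X * fps_deriv ?B) = \<infinity>"
      using fps_conv_radius_mult[of fps_X "fps_deriv ?B"] rad' by simp
    have "(phi \<nu> has_field_derivative eval_fps ?B x + z * (eval_fps (fps_deriv ?B) x * (z / of_real \<nu>))) (at z)"
    proof -
      have "((\<lambda>z. z * eval_fps ?B (z\<^sup>2 / of_real (2 * \<nu>))) has_field_derivative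
              eval_fps ?B x + z * (eval_fps (fps_deriv ?B) x * (z / of_real \<nu>))) (at z)"
        using nu rad unfolding x_def
        by (auto intro!: derivative_eq_intros DERIV_chain2[OF has_field_derivative_eval_fps]
                 simp: field_simps)
      moreover have "phi \<nu> = (\<lambda>z. z * eval_fps ?B (z\<^sup>2 / of_real (2 * \<nu>)))"
        by (rule ext) (rule phi_eq_eval_bessel_fps[OF nu])
      ultimately show ?thesis by simp
    qed
    hence "z * deriv (phi \<nu>) z = z * (eval_fps ?B x + 2 * x * eval_fps (fps_deriv ?B) x)"
      using nu by (simp add: DERIV_imp_deriv x_def field_simps power2_eq_square)
    also have "2 * x * eval_fps (fps_deriv ?B) x = - (eval_fps ?G x * eval_fps ?B x)"
    proof -
      have "eval_fps (?G * ?B) x = eval_fps (- (fps_const 2 * (fps_X * fps_deriv ?B))) x"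
        using bessel_fps_log_deriv[OF nu] by (simp add: mult.assoc)
      thus ?thesis using radG rad rad' rad''
        by (simp add: eval_fps_mult eval_fps_minus fps_conv_radius_cmult_left)
    qed
    also have "z * (eval_fps ?B x + - (eval_fps ?G x * eval_fps ?B x)) =
      (1 - eval_fps ?G x) * (z * eval_fps ?B x)" by (simp add: algebra_simps)
    finally have "z * deriv (phi \<nu>) z = (1 - eval_fps ?G x) * (z * eval_fps ?B x)" .
    moreover have "phi \<nu> z = z * eval_fps ?B x"
      by (simp add: phi_eq_eval_bessel_fps[OF nu] x_def)
    ultimately show ?thesis using False nz by (simp add: starlike_quotient_def)
  qed
qed

text \<open>
  Nonnegative coefficients: on a circle about the origin the modulus is largest at the positive
  real point.  Hence the real part of \<open>1 - G\<close> first reaches \<open>0\<close> on the positive real axis.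
\<close>

lemma norm_eval_rayleigh_fps_le:
  assumes e: "\<epsilon> > 0" and x: "norm (x :: complex) < 1 / (2 * \<epsilon>)"
  shows "norm (eval_fps (rayleigh_fps \<epsilon>) x) \<le> eval_fps (rayleigh_fps \<epsilon> :: real fps) (norm x)"
proof -
  have rad: "ereal (norm x) < fps_conv_radius (rayleigh_fps \<epsilon> :: complex fps)"
    by (rule less_fps_conv_radius_rayleigh[OF e x])
  have eq: "norm (fps_nth (rayleigh_fps \<epsilon>) n * x ^ n) = fps_nth (rayleigh_fps \<epsilon>) n * norm x ^ n" for n
    using e by (simp add: norm_mult norm_power scaled_rayleigh_nonneg)
  show ?thesis
    using summable_norm[OF norm_summable_fps[OF rad]] unfolding eval_fps_def eq .
qed

lemma eval_rayleigh_fps_of_real: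
  assumes e: "\<epsilon> > 0" and x: "norm x < 1 / (2 * \<epsilon>)"
  shows "eval_fps (rayleigh_fps \<epsilon>) (complex_of_real x) = of_real (eval_fps (rayleigh_fps \<epsilon>) x)"
proof -
  have rad: "ereal (norm x) < fps_conv_radius (rayleigh_fps \<epsilon> :: real fps)"
    by (rule less_fps_conv_radius_rayleigh[OF e x])
  show ?thesis
    using suminf_of_real[OF summable_fps[OF rad], where 'a = complex] by (simp add: eval_fps_def)
qed

text \<open>
  Every power contributes nonnegatively to the difference, so the linear term alone is a lower
  bound.  This makes the solution of \<open>G(x) = 1\<close> unique and stable under perturbation.
\<close>

lemma eval_rayleigh_fps_diff_ge:
  assumes e: "\<epsilon> > 0" and x: "0 \<le> x" "x \<le> y" "y < 1 / (2 * \<epsilon>)"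
  shows "eval_fps (rayleigh_fps \<epsilon>) y - eval_fps (rayleigh_fps \<epsilon>) x \<ge> (y - x) / (1 + \<epsilon>)"
proof -
  let ?c = "scaled_rayleigh \<epsilon>"
  have rad: "ereal (norm t) < fps_conv_radius (rayleigh_fps \<epsilon> :: real fps)" if "t \<in> {x, y}" for t
    using that x by (intro less_fps_conv_radius_rayleigh[OF e]) auto
  have sm: "summable (\<lambda>n. ?c n * t ^ n)" if "t \<in> {x, y}" for t
    using summable_fps[OF rad[OF that]] by simp
  have "(y - x) / (1 + \<epsilon>) = (\<Sum>n\<in>{1}. ?c n * y ^ n - ?c n * x ^ n)"
    by (simp add: scaled_rayleigh_1 diff_divide_distrib)
  also have "\<dots> \<le> (\<Sum>n. ?c n * y ^ n - ?c n * x ^ n)"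
    using x e by (intro sum_le_suminf summable_diff sm)
      (auto intro!: mult_left_mono power_mono scaled_rayleigh_nonneg)
  also have "\<dots> = eval_fps (rayleigh_fps \<epsilon>) y - eval_fps (rayleigh_fps \<epsilon>) x"
    by (simp add: eval_fps_def suminf_diff sm)
  finally show ?thesis .
qed

text \<open>
  The bound \<open>\<nu> > 4\<close> puts the point \<open>2\<close> inside the disc \<open>\<bar>x\<bar> < \<nu>/2\<close>; there the linear term
  \<open>2/(1 + 1/\<nu>)\<close> already exceeds \<open>1\<close>, so \<open>G\<close> takes the value \<open>1\<close> at some \<open>X < 2\<close>.  Up to
  \<open>\<bar>x\<bar> = X\<close> the starlikeness condition holds, and at \<open>x = X\<close> it fails.
\<close>

lemma starlikeness_radius_phi:
  assumes nu: "\<nu> > 4"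
  obtains X where "0 < X" "X < 2" "eval_fps (rayleigh_fps (1 / \<nu>)) X = 1"
    "starlikeness_radius (phi \<nu>) = ereal (sqrt (2 * \<nu> * X))"
proof -
  define \<epsilon> where "\<epsilon> = 1 / \<nu>"
  define g where "g = eval_fps (rayleigh_fps \<epsilon> :: real fps)"
  have e: "\<epsilon> > 0" and e2: "2 < 1 / (2 * \<epsilon>)" and e3: "\<epsilon> < 1" using nu by (auto simp: \<epsilon>_def field_simps)
  have g0: "g 0 = 0" by (simp add: g_def eval_fps_at_0)
  have "continuous_on {0..2} g"
    unfolding g_def
  proof (rule continuous_on_subset[OF continuous_on_eval_fps])
    show "{0..2::real} \<subseteq> eball 0 (fps_conv_radius (rayleigh_fps \<epsilon> :: real fps))"
    proof
      fix x :: real assume "x \<in> {0..2}"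
      thus "x \<in> eball 0 (fps_conv_radius (rayleigh_fps \<epsilon> :: real fps))"
        using e2 less_fps_conv_radius_rayleigh[OF e, of x] by simp
    qed
  qed
  moreover have "g 2 \<ge> 2 / (1 + \<epsilon>)"
    using eval_rayleigh_fps_diff_ge[of \<epsilon> 0 2] e e2 g0 by (simp add: g_def)
  moreover have "2 / (1 + \<epsilon>) > 1" using e e3 by (simp add: field_simps)
  ultimately have "\<exists>X\<ge>0. X \<le> 2 \<and> g X = 1" and g2: "g 2 > 1"
    using IVT'[of g 0 1 2] g0 by auto
  then obtain X where X: "0 \<le> X" "X \<le> 2" "g X = 1" by blast
  have X': "0 < X" "X < 2" using X g0 g2 by (auto simp: order_less_le)
  \<comment> \<open>The radius stays below \<open>\<nu>\<close>, so that \<open>x = z\<^sup>2/(2\<nu>)\<close> stays in \<open>\<bar>x\<bar> < \<nu>/2\<close>, where \<open>G\<close> converges.\<close>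
  have nuX: "sqrt (2 * \<nu> * X) < \<nu>"
    using X' nu by (intro real_less_lsqrt) (auto simp: power2_eq_square intro!: mult_strict_right_mono)
  define r0 where "r0 = sqrt (2 * \<nu> * X)"
  have r0: "r0 > 0" "r0 ^ 2 = 2 * \<nu> * X" using X' nu by (auto simp: r0_def)
  have "{ereal r | r. r > 0 \<and> (\<forall>z\<in>ball 0 r. (z \<noteq> 0 \<longrightarrow> phi \<nu> z \<noteq> 0) \<and> Re (starlike_quotient (phi \<nu>) z) > 0)}
        = {ereal r | r. 0 < r \<and> r \<le> r0}"
  proof (intro Collect_cong ex_cong1 conj_cong refl iffI)
    fix r assume r: "0 < r"
      "\<forall>z\<in>ball 0 r. (z \<noteq> 0 \<longrightarrow> phi \<nu> z \<noteq> 0) \<and> Re (starlike_quotient (phi \<nu>) z) > 0"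
    show "r \<le> r0"
    proof (rule ccontr)
      assume "\<not> r \<le> r0"
      hence "Re (starlike_quotient (phi \<nu>) (of_real r0)) > 0" using r r0 by auto
      moreover have "starlike_quotient (phi \<nu>) (of_real r0) = 1 - eval_fps (rayleigh_fps \<epsilon>) (of_real X)"
        using starlike_quotient_phi(2)[of \<nu> "of_real r0"] nuX nu r0
        by (simp add: r0_def[symmetric] \<epsilon>_def flip: of_real_power)
      moreover have "eval_fps (rayleigh_fps \<epsilon>) (complex_of_real X) = 1"
        using eval_rayleigh_fps_of_real[of \<epsilon> X] e e2 X by (simp add: g_def)
      ultimately show False by simp
    qed
  next
    fix r assume r: "0 < r" "r \<le> r0"
    show "\<forall>z\<in>ball 0 r. (z \<noteq> 0 \<longrightarrow> phi \<nu> z \<noteq> 0) \<and> Re (starlike_quotient (phi \<nu>) z) > 0"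
    proof
      fix z :: complex assume "z \<in> ball 0 r"
      hence z: "norm z < r0" using r by simp
      hence z': "norm z < \<nu>" using nuX by (simp add: r0_def)
      define x where "x = z\<^sup>2 / of_real (2 * \<nu>)"
      have "norm z ^ 2 < r0 ^ 2" using z by (intro power_strict_mono) auto
      hence x: "norm x < X" using nu by (simp add: r0 x_def norm_divide norm_power field_simps)
      have "Re (eval_fps (rayleigh_fps \<epsilon>) x) \<le> norm (eval_fps (rayleigh_fps \<epsilon>) x)"
        by (rule complex_Re_le_cmod)
      also have "\<dots> \<le> g (norm x)"
        unfolding g_def using x X e2 by (intro norm_eval_rayleigh_fps_le e) auto
      also have "\<dots> < g X"
      proof -
        have "(X - norm x) / (1 + \<epsilon>) \<le> g X - g (norm x)"
          unfolding g_def using e e2 x X by (intro eval_rayleigh_fps_diff_ge) auto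
        moreover have "(X - norm x) / (1 + \<epsilon>) > 0" using x e by simp
        ultimately show ?thesis by linarith
      qed
      finally have "Re (1 - eval_fps (rayleigh_fps \<epsilon>) x) > 0" using X by simp
      thus "(z \<noteq> 0 \<longrightarrow> phi \<nu> z \<noteq> 0) \<and> Re (starlike_quotient (phi \<nu>) z) > 0"
        using starlike_quotient_phi[of \<nu> z] z' nu by (simp add: x_def \<epsilon>_def)
    qed
  qed
  hence "starlikeness_radius (phi \<nu>) = Sup {ereal r | r. 0 < r \<and> r \<le> r0}"
    by (simp add: starlikeness_radius_def)
  also have "\<dots> = ereal r0"
    using r0 by (intro Sup_eqI) auto
  finally show ?thesis
    using that[of X] X X' by (simp add: g_def \<epsilon>_def r0_def)
qed

section \<open>Expansion of the Rayleigh sums for large order\<close>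

lemma geometric_fps_expansion:
  fixes c :: real
  shows "(\<lambda>x. 1 / (1 + c * x)) has_fps_expansion Abs_fps (\<lambda>m. (- c) ^ m)"
proof -
  let ?F = "1 + fps_const c * fps_X"
  have "?F * Abs_fps (\<lambda>m. (- c) ^ m) = 1"
  proof (rule fps_ext)
    show "fps_nth (?F * Abs_fps (\<lambda>m. (- c) ^ m)) m = fps_nth 1 m" for m
      by (cases m) (simp_all add: ring_distribs mult.assoc)
  qed
  hence "inverse ?F = Abs_fps (\<lambda>m. (- c) ^ m)"
    by (intro fps_inverse_unique) auto
  moreover have "(\<lambda>x. inverse (1 + c * x)) has_fps_expansion inverse ?F"
    by (intro fps_expansion_intros) auto
  ultimately show ?thesis by (simp add: field_simps)
qed

lemma sigma_1: "sigma (Suc 0) m = (- 1) ^ m / 4"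
  by (simp add: sigma.simps)

text \<open>
  The factor \<open>\<Sum>\<^sub>m (-k)\<^sup>m X\<^sup>m = 1/(1 + k X)\<close> is the denominator in the recursion of the scaled
  Rayleigh sums.
\<close>

lemma sigma_fps_rec:
  assumes "k \<ge> 2"
  shows "Abs_fps (sigma k) =
    (\<Sum>n=1..k-1. Abs_fps (sigma n) * Abs_fps (sigma (k - n))) * Abs_fps (\<lambda>m. (- real k) ^ m)"
proof (rule fps_ext)
  fix m
  have "sigma k m = (\<Sum>i=0..m. (\<Sum>n=1..k-1. \<Sum>j=0..i. sigma n j * sigma (k - n) (i - j)) * (- real k) ^ (m - i))"
  proof -
    have "sigma k m = (\<Sum>i=0..m. \<Sum>j=0..i. \<Sum>n=1..k-1. (- real k) ^ (m - i) * sigma n j * sigma (k - n) (i - j))"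
      using assms by (subst sigma.simps) simp
    also have "\<dots> = (\<Sum>i=0..m. \<Sum>n=1..k-1. \<Sum>j=0..i. (- real k) ^ (m - i) * sigma n j * sigma (k - n) (i - j))"
      by (intro sum.cong refl sum.swap)
    finally show ?thesis by (simp add: sum_distrib_right sum_distrib_left mult_ac)
  qed
  thus "fps_nth (Abs_fps (sigma k)) m = fps_nth ((\<Sum>n=1..k-1. Abs_fps (sigma n) * Abs_fps (sigma (k - n))) *
      Abs_fps (\<lambda>m. (- real k) ^ m)) m"
    by (simp add: fps_mult_nth fps_sum_nth)
qed

text \<open>
  Both sides satisfy the same recursion.  The factor \<open>2\<^sup>n\<^sup>+\<^sup>1\<close> collects the \<open>1/4\<close> in the first
  row of \<open>\<sigma>\<close> and the \<open>1/2\<close> in the recursion, and \<open>X\<^sup>n\<^sup>-\<^sup>1\<close> the factor \<open>\<epsilon>\<close> picked up at each step.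
\<close>

lemma scaled_rayleigh_fps_expansion:
  assumes "n \<ge> 1"
  shows "(\<lambda>\<epsilon>. scaled_rayleigh \<epsilon> n) has_fps_expansion
           fps_const (2 ^ (n + 1)) * (fps_X ^ (n - 1) * Abs_fps (sigma n))"
  using assms
proof (induction n rule: less_induct)
  case (less n)
  show ?case
  proof (cases "n = 1")
    case True
    have "(\<lambda>\<epsilon>. 1 / (1 + 1 * \<epsilon>)) has_fps_expansion Abs_fps (\<lambda>m. (- 1 :: real) ^ m)"
      by (rule geometric_fps_expansion)
    moreover have "fps_const (2 ^ (n + 1)) * (fps_X ^ (n - 1) * Abs_fps (sigma n)) = Abs_fps (\<lambda>m. (- 1) ^ m)"
      using True by (intro fps_ext) (simp add: sigma_1)
    ultimately show ?thesis using True by (simp add: scaled_rayleigh_1)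
  next
    case False
    hence n: "n \<ge> 2" using less.prems by simp
    let ?C = "\<lambda>n. fps_const (2 ^ (n + 1)) * (fps_X ^ (n - 1) * Abs_fps (sigma n))"
    let ?geo = "Abs_fps (\<lambda>m. (- real n) ^ m)"
    have "(\<lambda>\<epsilon>. 1 / 2 * (\<epsilon> * (1 / (1 + real n * \<epsilon>) *
             (\<Sum>i=1..n-1. scaled_rayleigh \<epsilon> i * scaled_rayleigh \<epsilon> (n - i))))) has_fps_expansion
          fps_const (1 / 2) * (fps_X * (?geo * (\<Sum>i=1..n-1. ?C i * ?C (n - i))))"
      by (intro fps_expansion_intros geometric_fps_expansion less.IH) auto
    also have "(\<Sum>i=1..n-1. ?C i * ?C (n - i)) =
        (\<Sum>i=1..n-1. fps_const (2 ^ (n + 2)) * (fps_X ^ (n - 2) * (Abs_fps (sigma i) * Abs_fps (sigma (n - i)))))"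
    proof (intro sum.cong refl)
      fix i assume i: "i \<in> {1..n-1}"
      have c: "fps_const (2 ^ (i + 1)) * fps_const (2 ^ (n - i + 1)) = fps_const (2 ^ (n + 2) :: real)"
      proof -
        have "i + 1 + (n - i + 1) = n + 2" using i by auto
        thus ?thesis by (simp only: fps_const_mult flip: power_add)
      qed
      have X: "fps_X ^ (i - 1) * fps_X ^ (n - i - 1) = (fps_X ^ (n - 2) :: real fps)"
      proof -
        have "i - 1 + (n - i - 1) = n - 2" using i by auto
        thus ?thesis by (simp only: flip: power_add)
      qed
      have "?C i * ?C (n - i) = (fps_const (2 ^ (i + 1)) * fps_const (2 ^ (n - i + 1))) *
        ((fps_X ^ (i - 1) * fps_X ^ (n - i - 1)) * (Abs_fps (sigma i) * Abs_fps (sigma (n - i))))"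
        by (simp only: mult_ac)
      thus "?C i * ?C (n - i) =
        fps_const (2 ^ (n + 2)) * (fps_X ^ (n - 2) * (Abs_fps (sigma i) * Abs_fps (sigma (n - i))))"
        by (simp only: c X)
    qed
    also have "fps_const (1 / 2) * (fps_X * (?geo * \<dots>)) = (fps_const (1 / 2) * fps_const (2 ^ (n + 2))) *
        ((fps_X * fps_X ^ (n - 2)) *
        ((\<Sum>i=1..n-1. Abs_fps (sigma i) * Abs_fps (sigma (n - i))) * ?geo))"
      unfolding sum_distrib_left[symmetric] by (simp only: mult_ac)
    also have "\<dots> = ?C n"
    proof -
      have "fps_const (1 / 2) * fps_const (2 ^ (n + 2)) = fps_const (2 ^ (n + 1) :: real)" by simp
      moreover have "fps_X * fps_X ^ (n - 2) = (fps_X ^ (n - 1) :: real fps)"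
      proof -
        have "n - 1 = Suc (n - 2)" using n by simp
        thus ?thesis by (simp only: power_Suc)
      qed
      ultimately show ?thesis by (simp only: sigma_fps_rec[OF n])
    qed
    finally show ?thesis
      using n by (simp add: scaled_rayleigh_rec mult_ac)
  qed
qed

lemma has_fps_expansion_bigo:
  fixes f :: "real \<Rightarrow> real"
  assumes f: "f has_fps_expansion F" and F: "\<And>k. k < N \<Longrightarrow> fps_nth F k = 0"
  shows "f \<in> O[at_right 0](\<lambda>x. x ^ N)"
proof (rule bigoI_tendsto)
  define G where "G = fps_shift N F"
  have FG: "F = fps_X ^ N * G"
    by (rule fps_ext) (use F in \<open>auto simp: G_def fps_X_power_mult_nth\<close>)
  have rad: "fps_conv_radius G > 0" using f by (simp add: G_def has_fps_expansion_def)
  have G: "eval_fps G has_fps_expansion G" using rad by (rule eval_fps_has_fps_expansion)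
  have "(\<lambda>x. x ^ N * eval_fps G x) has_fps_expansion F"
    unfolding FG by (intro fps_expansion_intros G)
  hence "eventually (\<lambda>x. f x = x ^ N * eval_fps G x) (nhds 0)"
    using f unfolding has_fps_expansion_def by (auto elim: eventually_elim2)
  hence "eventually (\<lambda>x. f x = x ^ N * eval_fps G x) (at_right 0)"
    by (simp add: eventually_at_filter) (auto elim: eventually_mono)
  moreover have "eventually (\<lambda>x :: real. x \<noteq> 0) (at_right 0)"
    by (rule eventually_neq_at_within)
  ultimately have ev: "eventually (\<lambda>x. f x / x ^ N = eval_fps G x) (at_right 0)"
    by eventually_elim simp
  show "eventually (\<lambda>x :: real. x ^ N \<noteq> 0) (at_right 0)"
    using eventually_neq_at_within[of 0 0 "{0<..}"] by eventually_elim simp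
  have "continuous (at_right 0) (eval_fps G)"
    by (rule has_fps_expansion_imp_continuous[OF G])
  hence "(eval_fps G \<longlongrightarrow> eval_fps G 0) (at_right 0)" by (simp add: continuous_within)
  thus "((\<lambda>x. f x / x ^ N) \<longlongrightarrow> eval_fps G 0) (at_right 0)"
    by (simp add: tendsto_cong[OF ev])
qed

section \<open>The truncated expansion solves the equation approximately\<close>

definition rho_truncated :: "nat \<Rightarrow> real \<Rightarrow> real" where
  "rho_truncated N \<epsilon> = 1 + (\<Sum>k=1..N-1. rho k * \<epsilon> ^ k)"

definition rho_truncated_fps :: "nat \<Rightarrow> real fps" where
  "rho_truncated_fps N = Abs_fps (\<lambda>i. if i = 0 then 1 else if i < N then rho i else 0)"

lemma rho_truncated_fps_expansion: "rho_truncated N has_fps_expansion rho_truncated_fps N"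
proof -
  have "(\<lambda>\<epsilon>. 1 + (\<Sum>k=1..N-1. rho k * \<epsilon> ^ k)) has_fps_expansion
        1 + (\<Sum>k=1..N-1. fps_const (rho k) * fps_X ^ k)"
    by (intro fps_expansion_intros)
  also have "1 + (\<Sum>k=1..N-1. fps_const (rho k) * fps_X ^ k) = rho_truncated_fps N"
    by (rule fps_ext) (auto simp: rho_truncated_fps_def fps_sum_nth if_distrib[of "(*) _"] cong: if_cong)
  finally show ?thesis by (simp add: rho_truncated_def[abs_def])
qed

lemma rho_truncated_fps_power_nth:
  assumes "m < N"
  shows "fps_nth (rho_truncated_fps N ^ n) m = potential_poly (of_nat n) m rho"
proof -
  have "potential_poly (of_nat n) m rho = potential_poly (of_nat n) m (\<lambda>i. if i < N then rho i else 0)"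
    using assms by (intro potential_poly_cong) auto
  thus ?thesis by (simp add: potential_poly_of_nat rho_truncated_fps_def)
qed

text \<open>
  The recursion for \<open>\<rho>\<close>, with all terms on one side: the left-hand side is the coefficient of
  \<open>\<epsilon>\<^sup>k\<close> in \<open>\<Sum>\<^sub>n c\<^sub>n(\<epsilon>) (1 + \<rho>\<^sub>1 \<epsilon> + \<rho>\<^sub>2 \<epsilon>\<^sup>2 + \<dots>)\<^sup>n\<close>, where \<open>c\<^sub>n\<close> are the scaled Rayleigh sums.  Its
  terms with \<open>n = 1\<close> are those that stand outside the double sum in the recursion.
\<close>

lemma rho_convolution:
  "(\<Sum>n=1..k+1. 2 ^ (n + 1) * (\<Sum>m=0..k+1-n. sigma n (k + 1 - n - m) * potential_poly (of_nat n) m rho))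
     = (if k = 0 then 1 else 0)"
proof -
  let ?A = "\<lambda>n m. potential_poly (of_nat n) m rho"
  let ?T = "\<lambda>n. 2 ^ (n + 1) * (\<Sum>m=0..k+1-n. sigma n (k + 1 - n - m) * ?A n m)"
  have A1: "?A 1 m = (if m = 0 then 1 else rho m)" for m
    using potential_poly_of_nat[of 1 m rho] by simp
  have "{1..k+1} = insert 1 {2..k+1}" by auto
  hence "(\<Sum>n=1..k+1. ?T n) = ?T 1 + (\<Sum>n=2..k+1. ?T n)" by simp
  also have "?T 1 = (\<Sum>m=0..k. (- 1) ^ (k - m) * (if m = 0 then 1 else rho m))"
    using A1 by (simp add: sigma_1 sum_divide_distrib[symmetric])
  also have "\<dots> = (if k = 0 then 1 else (- 1) ^ k + (\<Sum>n=1..k-1. (- 1) ^ (k - n) * rho n) + rho k)"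
  proof (cases k)
    case (Suc j)
    have "{0..k} = insert 0 (insert k {1..k-1})" using Suc by auto
    thus ?thesis using Suc by (simp add: algebra_simps)
  qed simp
  also have "\<dots> + (\<Sum>n=2..k+1. ?T n) = (if k = 0 then 1 else 0)"
    using rho_rec[of k] by (cases "k = 0") simp_all
  finally show ?thesis .
qed

text \<open>
  Cutting the series in \<open>n\<close> at \<open>N\<close> does not affect coefficients below \<open>\<epsilon>\<^sup>N\<close>, since \<open>c\<^sub>n\<close> starts at
  \<open>\<epsilon>\<^sup>n\<^sup>-\<^sup>1\<close>.  What remains is a finite sum, to which the calculus of convergent expansions applies.
\<close>

lemma truncated_equation_bigo:
  "(\<lambda>\<epsilon>. (\<Sum>n=1..N. scaled_rayleigh \<epsilon> n * rho_truncated N \<epsilon> ^ n) - 1) \<in> O[at_right 0](\<lambda>\<epsilon>. \<epsilon> ^ N)"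
proof (rule has_fps_expansion_bigo)
  let ?C = "\<lambda>n. fps_const (2 ^ (n + 1)) * (fps_X ^ (n - 1) * Abs_fps (sigma n))"
  let ?P = "rho_truncated_fps N"
  have pow: "(\<lambda>\<epsilon>. rho_truncated N \<epsilon> ^ n) has_fps_expansion ?P ^ n" for n
    by (induction n) (auto intro!: fps_expansion_intros rho_truncated_fps_expansion)
  show "(\<lambda>\<epsilon>. (\<Sum>n=1..N. scaled_rayleigh \<epsilon> n * rho_truncated N \<epsilon> ^ n) - 1) has_fps_expansion
        (\<Sum>n=1..N. ?C n * ?P ^ n) - 1"
    by (intro fps_expansion_intros pow scaled_rayleigh_fps_expansion) auto
  fix k assume k: "k < N"
  have "fps_nth (?C n * ?P ^ n) k = (if n \<le> k + 1 then 2 ^ (n + 1) *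
      (\<Sum>m=0..k+1-n. sigma n (k + 1 - n - m) * potential_poly (of_nat n) m rho) else 0)" if "n \<ge> 1" for n
  proof -
    have "?C n * ?P ^ n = fps_const (2 ^ (n + 1)) * (fps_X ^ (n - 1) * (?P ^ n * Abs_fps (sigma n)))"
      by (simp only: mult_ac)
    hence "fps_nth (?C n * ?P ^ n) k =
        2 ^ (n + 1) * (if k < n - 1 then 0 else fps_nth (?P ^ n * Abs_fps (sigma n)) (k - (n - 1)))"
      by (simp only: fps_mult_left_const_nth fps_X_power_mult_nth)
    moreover have "k - (n - 1) = k + 1 - n" using that by simp
    moreover have "fps_nth (?P ^ n * Abs_fps (sigma n)) (k + 1 - n) =
        (\<Sum>m=0..k+1-n. sigma n (k + 1 - n - m) * potential_poly (of_nat n) m rho)"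
      unfolding fps_mult_nth
      using k that by (intro sum.cong refl) (simp add: rho_truncated_fps_power_nth)
    ultimately show ?thesis using that by auto
  qed
  hence "fps_nth (\<Sum>n=1..N. ?C n * ?P ^ n) k = (\<Sum>n=1..N. if n \<le> k + 1 then 2 ^ (n + 1) *
      (\<Sum>m=0..k+1-n. sigma n (k + 1 - n - m) * potential_poly (of_nat n) m rho) else 0)"
    unfolding fps_sum_nth by (intro sum.cong) auto
  also have "\<dots> = (\<Sum>n=1..k+1. 2 ^ (n + 1) *
      (\<Sum>m=0..k+1-n. sigma n (k + 1 - n - m) * potential_poly (of_nat n) m rho))"
    using k by (intro sum.mono_neutral_cong_right) auto
  also have "\<dots> = (if k = 0 then 1 else 0)" by (rule rho_convolution)
  finally have "fps_nth (\<Sum>n=1..N. ?C n * ?P ^ n) k = fps_nth 1 k" by (simp only: fps_one_nth)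
  thus "fps_nth ((\<Sum>n=1..N. ?C n * ?P ^ n) - 1) k = 0" by (simp only: fps_sub_nth diff_self)
qed

text \<open>
  The terms are at most \<open>(4\<epsilon>)\<^sup>n/\<epsilon>\<close> for \<open>x \<le> 2\<close>, and a geometric series with ratio
  \<open>4\<epsilon> \<le> 1/2\<close> is at most twice its first term, \<open>(4\<epsilon>)\<^sup>N\<^sup>+\<^sup>1/\<epsilon>\<close>.
\<close>

lemma eval_rayleigh_fps_tail_le:
  assumes e: "0 < \<epsilon>" "\<epsilon> \<le> 1 / 8" and x: "0 \<le> x" "x \<le> 2"
  shows "\<bar>eval_fps (rayleigh_fps \<epsilon>) x - (\<Sum>n=1..N. scaled_rayleigh \<epsilon> n * x ^ n)\<bar> \<le> 2 * 4 ^ (N + 1) * \<epsilon> ^ N"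
proof -
  let ?a = "\<lambda>n. scaled_rayleigh \<epsilon> n * x ^ n"
  define q where "q = 4 * \<epsilon>"
  have q: "0 < q" "q \<le> 1 / 2" using e by (auto simp: q_def)
  have a: "0 \<le> ?a n" "?a n \<le> q ^ n / \<epsilon>" for n
  proof -
    show "0 \<le> ?a n" using e x by (auto intro!: mult_nonneg_nonneg scaled_rayleigh_nonneg)
    have "?a n \<le> (2 * \<epsilon>) ^ n / \<epsilon> * 2 ^ n"
      using e x by (intro mult_mono scaled_rayleigh_le power_mono) auto
    also have "\<dots> = q ^ n / \<epsilon>"
    proof -
      have "q = 2 * \<epsilon> * 2" by (simp add: q_def)
      hence "q ^ n = (2 * \<epsilon>) ^ n * 2 ^ n" by (simp only: power_mult_distrib)
      thus ?thesis by simp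
    qed
    finally show "?a n \<le> q ^ n / \<epsilon>" .
  qed
  have sq: "summable (\<lambda>n. q ^ (N + 1) / \<epsilon> * q ^ n)"
    using q by (intro summable_mult[OF summable_geometric]) auto
  have "x < 1 / (2 * \<epsilon>)"
  proof -
    have "x * (2 * \<epsilon>) \<le> 2 * (2 * (1 / 8))" using e x by (intro mult_mono) auto
    thus ?thesis using e by (simp add: field_simps)
  qed
  hence sa: "summable ?a"
    using summable_fps[OF less_fps_conv_radius_rayleigh[of \<epsilon> x]] e x by simp
  have sa': "summable (\<lambda>n. ?a (n + (N + 1)))"
    by (rule summable_ignore_initial_segment[OF sa])
  have "{..<N+1} = insert 0 {1..N}" by auto
  hence "(\<Sum>n<N+1. ?a n) = (\<Sum>n=1..N. ?a n)" by simp
  hence "eval_fps (rayleigh_fps \<epsilon>) x - (\<Sum>n=1..N. ?a n) = (\<Sum>n. ?a (n + (N + 1)))"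
    using suminf_split_initial_segment[OF sa, of "N + 1"] by (simp add: eval_fps_def)
  moreover have "0 \<le> (\<Sum>n. ?a (n + (N + 1)))"
    by (rule suminf_nonneg[OF sa' a(1)])
  moreover have "(\<Sum>n. ?a (n + (N + 1))) \<le> (\<Sum>n. q ^ (N + 1) / \<epsilon> * q ^ n)"
  proof (rule suminf_le)
    show "?a (n + (N + 1)) \<le> q ^ (N + 1) / \<epsilon> * q ^ n" for n
      using a(2)[of "n + (N + 1)"] by (simp add: power_add mult_ac)
  qed (rule sa' sq)+
  moreover have "(\<Sum>n. q ^ (N + 1) / \<epsilon> * q ^ n) = q ^ (N + 1) / \<epsilon> * (1 / (1 - q))"
    using q by (subst suminf_mult) (auto simp: suminf_geometric)
  moreover have "\<dots> \<le> q ^ (N + 1) / \<epsilon> * 2"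
    using q e by (intro mult_left_mono) (auto simp: field_simps)
  moreover have "q ^ (N + 1) / \<epsilon> * 2 = 2 * 4 ^ (N + 1) * \<epsilon> ^ N"
    using e by (simp add: q_def power_mult_distrib)
  ultimately show ?thesis by simp
qed

lemma solution_distance_le:
  assumes e: "\<epsilon> > 0" and xy: "0 \<le> x" "x < 1 / (2 * \<epsilon>)" "0 \<le> y" "y < 1 / (2 * \<epsilon>)"
  shows "\<bar>x - y\<bar> \<le> (1 + \<epsilon>) * \<bar>eval_fps (rayleigh_fps \<epsilon>) x - eval_fps (rayleigh_fps \<epsilon>) y\<bar>"
proof -
  have *: "b - a \<le> (1 + \<epsilon>) * \<bar>eval_fps (rayleigh_fps \<epsilon>) b - eval_fps (rayleigh_fps \<epsilon>) a\<bar>"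
    if "0 \<le> a" "a \<le> b" "b < 1 / (2 * \<epsilon>)" for a b
  proof -
    have "(b - a) / (1 + \<epsilon>) \<le> \<bar>eval_fps (rayleigh_fps \<epsilon>) b - eval_fps (rayleigh_fps \<epsilon>) a\<bar>"
      using eval_rayleigh_fps_diff_ge[OF e that] by linarith
    thus ?thesis using e by (simp add: field_simps)
  qed
  show ?thesis
    using *[of x y] *[of y x] xy by (cases "x \<le> y") (auto simp: abs_minus_commute)
qed

section \<open>The first coefficients\<close>

lemma rho_values:
  "rho 1 = 1 / 2" "rho 2 = 1 / 2" "rho 3 = - 1 / 2" "rho 4 = - 1 / 2"
proof -
  have rec: "sigma k m = (\<Sum>i=0..m. \<Sum>j=0..i. \<Sum>n=1..k-1. (- real k) ^ (m - i) * sigma n j * sigma (k - n) (i - j))"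
    if "k \<ge> 2" for k m
    using that by (subst sigma.simps) simp
  \<comment> \<open>Only the \<open>\<sigma>\<^sub>m\<^sup>(\<^sup>n\<^sup>)\<close> with \<open>n + m \<le> 5\<close> enter \<open>\<rho>\<^sub>1, \<dots>, \<rho>\<^sub>4\<close>.\<close>
  have s2: "sigma 2 0 = 1 / 16" "sigma 2 (Suc 0) = - 1 / 4" "sigma 2 2 = 11 / 16" "sigma 2 3 = - 13 / 8"
    by (simp_all add: rec sigma_1 numeral_eq_Suc)
  have s3: "sigma 3 0 = 1 / 32" "sigma 3 (Suc 0) = - 1 / 4" "sigma 3 2 = 5 / 4"
    using s2 by (simp_all add: rec sigma_1 numeral_eq_Suc)
  have s4: "sigma 4 0 = 5 / 256" "sigma 4 (Suc 0) = - 1 / 4"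
    using s2 s3 by (simp_all add: rec sigma_1 numeral_eq_Suc)
  have s5: "sigma 5 0 = 7 / 512"
    using s2 s3 s4 by (simp_all add: rec sigma_1 numeral_eq_Suc)
  have gb: "(a :: real) gchoose 2 = a * (a - 1) / 2" for a
    by (simp add: numeral_2_eq_2 gbinomial_prod_rev)
  have A1: "potential_poly (of_nat n) (Suc 0) rho = n * rho 1" for n
    using potential_poly_1[of "of_nat n" rho] by simp
  have A2: "potential_poly (of_nat n) (Suc (Suc 0)) rho = n * rho 2 + n * (real n - 1) / 2 * (rho 1)\<^sup>2" for n
    using potential_poly_2[of "of_nat n" rho] unfolding gb by (simp add: numeral_2_eq_2)
  have A3: "potential_poly (of_nat 2) (Suc (Suc (Suc 0))) rho = 2 * rho 3 + 2 * rho 1 * rho 2"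
    unfolding potential_poly_of_nat by (simp add: numeral_eq_Suc fps_mult_nth)
  have range: "{2..2::nat} = {2}" "{2..3::nat} = {2,3}" "{2..4::nat} = {2,3,4}" "{2..5::nat} = {2,3,4,5}"
    "{Suc 0..2} = {1,2}" "{Suc 0..3} = {1,2,3}" "{0..Suc 0} = {0,1}" "{0..2::nat} = {0,1,2}" "{0..3::nat} = {0,1,2,3}"
    by auto
  show r1: "rho 1 = 1 / 2"
    using rho_rec[of 1] s2 by (simp add: potential_poly_0 A1 A2 numeral_2_eq_2)
  have A': "potential_poly 2 0 rho = 1" "potential_poly 3 0 rho = 1" "potential_poly 4 0 rho = 1" "potential_poly 5 0 rho = 1"
    "potential_poly 2 (Suc 0) rho = 2 * rho 1" "potential_poly 3 (Suc 0) rho = 3 * rho 1"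
    "potential_poly 4 (Suc 0) rho = 4 * rho 1"
    "potential_poly 2 2 rho = 2 * rho 2 + (rho 1)\<^sup>2" "potential_poly 3 2 rho = 3 * rho 2 + 3 * (rho 1)\<^sup>2"
    "potential_poly 2 3 rho = 2 * rho 3 + 2 * rho 1 * rho 2"
    using A1[of 2] A1[of 3] A1[of 4] A2[of 2] A2[of 3] A3 by (simp_all add: potential_poly_0 numeral_eq_Suc)
  note r1' = r1[unfolded One_nat_def]
  note vals = s2 s3 s4 s5 A' range
  show r2: "rho 2 = 1 / 2"
    using rho_rec[of 2] by (simp add: r1' vals)
  show r3: "rho 3 = - 1 / 2"
    using rho_rec[of 3] by (simp add: r1' r2 vals power2_eq_square)
  show "rho 4 = - 1 / 2"
    using rho_rec[of 4] by (simp add: r1' r2 r3 vals power2_eq_square)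
qed

section \<open>The asymptotic expansion\<close>

text \<open>
  The exact solution \<open>X\<close> satisfies \<open>G(X) = 1\<close>, the truncation \<open>R\<close> satisfies
  \<open>G(R) = 1 + O(\<epsilon>\<^sup>N)\<close>, and \<open>\<bar>X - R\<bar>\<close> is controlled by \<open>\<bar>G(X) - G(R)\<bar>\<close>.
\<close>

lemma starlikeness_radius_expansion:
  "(\<lambda>\<nu>. (real_of_ereal (starlikeness_radius (phi \<nu>)))\<^sup>2 / (2 * \<nu>) - rho_truncated N (1 / \<nu>))
     \<in> O[at_top](\<lambda>\<nu>. 1 / \<nu> ^ N)"
proof -
  have lim: "filterlim (\<lambda>\<nu>::real. 1 / \<nu>) (at_right 0) at_top"
    using filterlim_inverse_at_right_top by (simp add: inverse_eq_divide)
  define H where "H = (\<lambda>\<epsilon>. \<Sum>n=1..N. scaled_rayleigh \<epsilon> n * rho_truncated N \<epsilon> ^ n)"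
  have "(\<lambda>\<nu>. H (1 / \<nu>) - 1) \<in> O[at_top](\<lambda>\<nu>. (1 / \<nu>) ^ N)"
    using landau_o.big.compose[OF truncated_equation_bigo lim] by (simp add: H_def)
  then obtain c where ev1: "eventually (\<lambda>\<nu>. norm (H (1 / \<nu>) - 1) \<le> c * norm ((1 / \<nu>) ^ N)) at_top"
    by (elim landau_o.bigE)
  have "continuous (at_right 0) (rho_truncated N)"
    by (rule has_fps_expansion_imp_continuous[OF rho_truncated_fps_expansion])
  hence "(rho_truncated N \<longlongrightarrow> rho_truncated N 0) (at_right 0)" by (simp add: continuous_within)
  moreover have "rho_truncated N 0 = 1" by (auto simp: rho_truncated_def intro!: sum.neutral)
  ultimately have "((\<lambda>\<nu>. rho_truncated N (1 / \<nu>)) \<longlongrightarrow> 1) at_top"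
    using filterlim_compose[OF _ lim] by metis
  hence ev2: "eventually (\<lambda>\<nu>. rho_truncated N (1 / \<nu>) \<in> {0<..<2}) at_top"
    by (rule topological_tendstoD) auto
  show ?thesis
  proof (rule landau_o.bigI)
    show "2 * (\<bar>c\<bar> + 2 * 4 ^ (N + 1)) > 0" by (intro mult_pos_pos add_nonneg_pos) auto
    show "eventually (\<lambda>\<nu>. norm ((real_of_ereal (starlikeness_radius (phi \<nu>)))\<^sup>2 / (2 * \<nu>) - rho_truncated N (1 / \<nu>))
            \<le> (2 * (\<bar>c\<bar> + 2 * 4 ^ (N + 1))) * norm (1 / \<nu> ^ N)) at_top"
      using ev1 ev2 eventually_ge_at_top[of 8]
    proof eventually_elim
      case (elim \<nu>)
      define \<epsilon> R where "\<epsilon> = 1 / \<nu>" and "R = rho_truncated N \<epsilon>"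
      have e: "0 < \<epsilon>" "\<epsilon> \<le> 1 / 8" "2 < 1 / (2 * \<epsilon>)" using elim by (auto simp: \<epsilon>_def field_simps)
      have R: "0 < R" "R < 2" using elim by (auto simp: R_def \<epsilon>_def)
      let ?g = "eval_fps (rayleigh_fps \<epsilon>) :: real \<Rightarrow> real"
      obtain X where X: "0 < X" "X < 2" "?g X = 1"
          "starlikeness_radius (phi \<nu>) = ereal (sqrt (2 * \<nu> * X))"
        using starlikeness_radius_phi[of \<nu>] elim by (auto simp: \<epsilon>_def)
      have X_eq: "(real_of_ereal (starlikeness_radius (phi \<nu>)))\<^sup>2 / (2 * \<nu>) = X"
        using X elim by simp
      have "\<bar>X - R\<bar> \<le> (1 + \<epsilon>) * \<bar>?g X - ?g R\<bar>"
        using e R X by (intro solution_distance_le) auto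
      also have "\<dots> \<le> 2 * \<bar>?g X - ?g R\<bar>"
        using e by (intro mult_right_mono) auto
      also have "\<bar>?g X - ?g R\<bar> \<le> \<bar>H \<epsilon> - 1\<bar> + \<bar>?g R - H \<epsilon>\<bar>"
        using X by linarith
      also have "\<dots> \<le> \<bar>c\<bar> * \<epsilon> ^ N + 2 * 4 ^ (N + 1) * \<epsilon> ^ N"
      proof (rule add_mono)
        have "\<bar>H \<epsilon> - 1\<bar> \<le> c * \<epsilon> ^ N" using elim e by (simp add: \<epsilon>_def)
        also have "\<dots> \<le> \<bar>c\<bar> * \<epsilon> ^ N" using e by (intro mult_right_mono) auto
        finally show "\<bar>H \<epsilon> - 1\<bar> \<le> \<bar>c\<bar> * \<epsilon> ^ N" .
        show "\<bar>?g R - H \<epsilon>\<bar> \<le> 2 * 4 ^ (N + 1) * \<epsilon> ^ N"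
          unfolding H_def R_def[symmetric] using e R by (intro eval_rayleigh_fps_tail_le) auto
      qed
      finally have "\<bar>X - R\<bar> \<le> 2 * (\<bar>c\<bar> + 2 * 4 ^ (N + 1)) * \<epsilon> ^ N"
        by (simp add: algebra_simps)
      thus ?case unfolding X_eq using e elim by (simp add: R_def \<epsilon>_def power_divide)
    qed
  qed
qed

theorem theorem2:
  shows "(\<forall>N\<ge>1. (\<lambda>\<nu>::real. (real_of_ereal (starlikeness_radius (phi \<nu>)))\<^sup>2 / (2 * \<nu>)
                    - (1 + (\<Sum>k=1..N-1. rho k / \<nu> ^ k)))
                 \<in> O[at_top](\<lambda>\<nu>. 1 / \<nu> ^ N))
       \<and> rho 1 = 1 / 2 \<and> rho 2 = 1 / 2 \<and> rho 3 = - 1 / 2 \<and> rho 4 = - 1 / 2"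
proof -
  have trunc: "rho_truncated N (1 / \<nu>) = 1 + (\<Sum>k=1..N-1. rho k / \<nu> ^ k)" for N \<nu>
    by (simp add: rho_truncated_def power_divide)
  show ?thesis
    by (intro conjI allI impI starlikeness_radius_expansion[unfolded trunc] rho_values)
qed

end
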